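(* Let $\mathcal H$ be a real Hilbert space, $C\subseteq\mathcal H$ nonempty closed convex, and let $B\colon\mathcal H\to\mathcal H$ be monotone and $L$-Lipschitz ($L>0$) with $S\neq\varnothing$, where $S$ is the solution set of the variational inequality $\mathrm{VI}(C,B)$. Let $(\beta_k)$ satisfy $0\le\beta_k\le\tfrac14$ and $\sum_k\beta_k<\infty$, set $\theta_k=1-\beta_k$, fix $x_{-1}=x_0=u_0\in C$, let $\lambda\in(0,\tfrac1{5L})$, and define $$x_{k+1}=P_C\bigl(x_k-\lambda B(u_k)\bigr)\quad(k\ge0),\qquad u_k=x_k+\theta_k(x_k-x_{k-1})+\beta_k(x_k-u_{k-1})\quad(k\ge1).$$ Then $(x_k)$ converges weakly to a point of $S$, with $\|x_{k+1}-x_k\|\to0$ and $\|u_k-x_k\|\to0$.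
   Context: $P_C$ is the metric projection onto $C$. $B$ is monotone if $\langle B(x)-B(y),x-y\rangle\ge0$ for all $x,y\in\mathcal H$, and $L$-Lipschitz if $\|B(x)-B(y)\|\le L\|x-y\|$ for all $x,y\in\mathcal H$. The solution set is $S=\{z\in C:\langle B(z),x-z\rangle\ge0\ \forall x\in C\}$. *)

theory Defs
  imports "HOL-Analysis.Analysis"
begin

(* Real Hilbert spaces are rendered by the sort {real_inner, complete_space}. *)

(* The library's closest_point has the additional sort constraint heine_borel, which excludes
   infinite-dimensional spaces.  For C nonempty, closed and convex in a Hilbert space the
   minimiser below exists and is unique. *)
definition metric_proj :: "'a::{real_inner,complete_space} set \<Rightarrow> 'a \<Rightarrow> 'a" where
  "metric_proj C a = (THE p. p \<in> C \<and> (\<forall>y\<in>C. dist a p \<le> dist a y))"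

definition monotone_operator :: "('a::real_inner \<Rightarrow> 'a) \<Rightarrow> bool" where
  "monotone_operator B \<longleftrightarrow> (\<forall>x y. 0 \<le> (B x - B y) \<bullet> (x - y))"

definition VI_solutions :: "'a::real_inner set \<Rightarrow> ('a \<Rightarrow> 'a) \<Rightarrow> 'a set" where
  "VI_solutions C B = {z \<in> C. \<forall>x\<in>C. 0 \<le> B z \<bullet> (x - z)}"

definition weakly_converges_to :: "(nat \<Rightarrow> 'a::real_normed_vector) \<Rightarrow> 'a \<Rightarrow> bool" where
  "weakly_converges_to x l \<longleftrightarrow>
     (\<forall>f :: 'a \<Rightarrow> real. bounded_linear f \<longrightarrow> (\<lambda>k. f (x k)) \<longlonglongrightarrow> f l)"

end

theory Submission
  imports Defs
begin

text \<open>
  With \<open>e\<^sub>k = u\<^sub>k - x\<^sub>k\<close> and \<open>d\<^sub>k = x\<^sub>k - x\<^bsub>k-1\<^esub>\<close> the extrapolation reads \<open>e\<^sub>k = d\<^sub>k - \<beta>\<^sub>k e\<^bsub>k-1\<^esub>\<close>, so the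
  scheme is a summable perturbation of the projected reflected gradient method.  For a solution
  \<open>z\<close>, the quantity \<open>\<parallel>x\<^sub>k - z\<parallel>\<^sup>2\<close>, augmented by multiples of \<open>\<parallel>e\<^bsub>k-1\<^esub>\<parallel>\<^sup>2\<close>, \<open>\<parallel>x\<^sub>k - u\<^bsub>k-1\<^esub>\<parallel>\<^sup>2\<close> and
  \<open>\<langle>B z, x\<^bsub>k-1\<^esub> - z\<rangle>\<close>, decreases up to a factor \<open>1 + \<beta>\<^sub>k\<close>.  Hence \<open>\<parallel>x\<^sub>k - z\<parallel>\<close> converges and the
  residuals vanish.  Weak convergence follows as in Opial's lemma; weak sequential compactness is
  replaced by the fact that the closed convex hulls of the tails of a bounded sequence have a
  common point, and Minty's characterisation shows that such a point solves the variational
  inequality.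
\<close>

section \<open>Metric projection and nested closed convex sets\<close>

text \<open>The near-minimisers in \<open>C\<close> form a decreasing sequence of closed sets. By
  the parallelogram law and the convexity of \<open>C\<close> their diameters tend to zero, so
  completeness yields a common point, which attains the infimum.\<close>

lemma min_dist_ex:
  fixes C :: "'a::{real_inner,complete_space} set"
  assumes C: "C \<noteq> {}" "closed C" "convex C"
  obtains p where "p \<in> C" "\<And>y. y \<in> C \<Longrightarrow> dist a p \<le> dist a y"
proof -
  define d where "d = infdist a C"
  have d0: "d \<ge> 0" unfolding d_def by (rule infdist_nonneg)
  have d: "d \<le> dist a y" if "y \<in> C" for y unfolding d_def using that by (rule infdist_le)
  define S where "S n = C \<inter> cball a (sqrt (d\<^sup>2 + 1 / Suc n))" for n
  obtain p where p: "p \<in> S n" for n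
  proof (rule decreasing_closed_nest)
    show "closed (S n)" for n unfolding S_def using C(2) by auto
    show "S n \<noteq> {}" for n
    proof -
      have "d < sqrt (d\<^sup>2 + 1 / Suc n)" by (rule real_less_rsqrt) simp
      then obtain y where "y \<in> C" "dist a y < sqrt (d\<^sup>2 + 1 / Suc n)"
        unfolding d_def using C(1) by (auto simp: infdist_notempty cINF_less_iff)
      then show ?thesis unfolding S_def by auto
    qed
    show "S n \<subseteq> S m" if "m \<le> n" for m n
      unfolding S_def using that by (intro Int_mono subset_cball) (auto intro!: divide_left_mono)
    fix e :: real assume "e > 0"
    \<comment> \<open>The estimate below bounds squared distances in \<open>S n\<close> by
      \<open>4 / Suc n\<close>; hence the factor 1/4.\<close>
    then have "e\<^sup>2 / 4 > 0" by simp
    then obtain n where n: "1 / real (Suc n) < e\<^sup>2 / 4" by (meson nat_approx_posE)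
    have "dist y z < e" if "y \<in> S n" "z \<in> S n" for y z
    proof -
      have yz: "y \<in> C" "z \<in> C" "(dist a y)\<^sup>2 \<le> d\<^sup>2 + 1 / Suc n" "(dist a z)\<^sup>2 \<le> d\<^sup>2 + 1 / Suc n"
        using that unfolding S_def by (auto simp: real_le_rsqrt sqrt_ge_absD)
      have "(1/2) *\<^sub>R y + (1/2) *\<^sub>R z \<in> C"
        using C(3) yz(1,2) by (rule convexD) auto
      then have "d \<le> norm ((1/2) *\<^sub>R y + (1/2) *\<^sub>R z - a)" using d by (metis dist_commute dist_norm)
      then have "d\<^sup>2 \<le> (norm ((1/2) *\<^sub>R y + (1/2) *\<^sub>R z - a))\<^sup>2" using d0 by (intro power_mono)
      \<comment> \<open>Parallelogram law for \<open>y - a\<close> and \<open>z - a\<close>; half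
        their sum is the midpoint minus \<open>a\<close>.\<close>
      moreover have "(dist y z)\<^sup>2 + 4 * (norm ((1/2) *\<^sub>R y + (1/2) *\<^sub>R z - a))\<^sup>2
          = 2 * (dist a y)\<^sup>2 + 2 * (dist a z)\<^sup>2"
        unfolding dist_norm power2_norm_eq_inner
        by (simp add: inner_diff inner_add inner_commute algebra_simps)
      ultimately have "(dist y z)\<^sup>2 < e\<^sup>2" using yz(3,4) n by argo
      then show ?thesis using \<open>e > 0\<close> power_less_imp_less_base by force
    qed
    then show "\<exists>n. \<forall>y\<in>S n. \<forall>z\<in>S n. dist y z < e" by blast
  qed blast
  have "dist a p \<le> d"
  proof (rule LIMSEQ_le_const)
    have "(\<lambda>n. sqrt (d\<^sup>2 + 1 / Suc n)) \<longlonglongrightarrow> sqrt (d\<^sup>2 + 0)"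
      by (intro tendsto_intros LIMSEQ_Suc lim_1_over_n)
    then show "(\<lambda>n. sqrt (d\<^sup>2 + 1 / Suc n)) \<longlonglongrightarrow> d" using d0 by simp
  qed (use p in \<open>auto simp: S_def\<close>)
  with d p[of 0] show ?thesis by (intro that) (auto simp: S_def intro: order_trans)
qed

text \<open>Uniqueness of the nearest point resolves the \<open>THE\<close>. Membership and the
  obtuse-angle inequality are all that later arguments use of the projection.\<close>

lemma metric_proj_props:
  fixes C :: "'a::{real_inner,complete_space} set"
  assumes C: "C \<noteq> {}" "closed C" "convex C"
  shows metric_proj_in: "metric_proj C a \<in> C"
    and metric_proj_variational: "y \<in> C \<Longrightarrow> (a - metric_proj C a) \<bullet> (y - metric_proj C a) \<le> 0"
proof -
  obtain p where p: "p \<in> C" "\<And>y. y \<in> C \<Longrightarrow> dist a p \<le> dist a y"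
    using min_dist_ex[OF C] by blast
  have "metric_proj C a = p"
    unfolding metric_proj_def
  proof (rule the_equality)
    fix q assume q: "q \<in> C \<and> (\<forall>y\<in>C. dist a q \<le> dist a y)"
    then show "q = p"
      using any_closest_point_unique[OF C(3,2), of q p a] p by blast
  qed (use p in auto)
  then show "metric_proj C a \<in> C"
    "y \<in> C \<Longrightarrow> (a - metric_proj C a) \<bullet> (y - metric_proj C a) \<le> 0"
    using any_closest_point_dot[OF C(3,2), of p y a] p by auto
qed

text \<open>The points of least norm form a Cauchy sequence.\<close>
lemma nested_closed_convex_inter:
  fixes K :: "nat \<Rightarrow> 'a::{real_inner,complete_space} set"
  assumes K: "\<And>n. K n \<noteq> {}" "\<And>n. closed (K n)" "\<And>n. convex (K n)"
    and dec: "decseq K" and bd: "bounded (K 0)"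
  shows "(\<Inter>n. K n) \<noteq> {}"
proof -
  define p where "p n = metric_proj (K n) 0" for n
  have pK: "p n \<in> K n" for n unfolding p_def using metric_proj_in[OF K] .
  have sub: "K m \<subseteq> K n" if "n \<le> m" for m n using dec that by (simp add: decseqD)
  \<comment> \<open>The obtuse-angle inequality at \<open>p n\<close> bounds squared distances by
    increments of the squared norms. These are monotone and bounded, hence Cauchy, and so is
    \<open>p\<close>.\<close>
  have diff: "(norm (p m - p n))\<^sup>2 \<le> (norm (p m))\<^sup>2 - (norm (p n))\<^sup>2" if "n \<le> m" for m n
  proof -
    have "p m \<in> K n" using pK sub[OF that] by blast
    then have "(0 - p n) \<bullet> (p m - p n) \<le> 0"
      unfolding p_def by (rule metric_proj_variational[OF K])
    then show ?thesis
      by (simp add: power2_norm_eq_inner inner_diff inner_commute)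
  qed
  obtain M where M: "norm y \<le> M" if "y \<in> K 0" for y using bd by (auto simp: bounded_iff)
  have "M \<ge> norm (p n)" for n using M pK sub[of 0 n] by blast
  then have "Bseq (\<lambda>n. (norm (p n))\<^sup>2)"
    by (intro BseqI'[of _ "M\<^sup>2"]) (auto intro!: power_mono)
  moreover have "incseq (\<lambda>n. (norm (p n))\<^sup>2)"
    using diff by (intro incseq_SucI) (metis diff_ge_0_iff_ge le_SucI order.refl order.trans zero_le_power2)
  ultimately have "convergent (\<lambda>n. (norm (p n))\<^sup>2)"
    by (simp add: Bseq_monoseq_convergent incseq_imp_monoseq)
  then have C: "Cauchy (\<lambda>n. (norm (p n))\<^sup>2)" by (rule convergent_Cauchy)
  have "Cauchy p"
  proof (rule CauchyI')
    fix e :: real assume "e > 0"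
    then obtain N where N: "\<And>m n. m \<ge> N \<Longrightarrow> n \<ge> N \<Longrightarrow> norm ((norm (p m))\<^sup>2 - (norm (p n))\<^sup>2) < e\<^sup>2"
      using CauchyD[OF C, of "e\<^sup>2"] by auto
    have "norm (p n - p m) < e" if "N \<le> n" "n < m" for m n
    proof -
      have "(norm (p m - p n))\<^sup>2 < e\<^sup>2"
        using diff[of n m] N[of m n] that by (simp add: abs_less_iff)
      then show ?thesis using \<open>e > 0\<close>
        by (metis norm_minus_commute power_less_imp_less_base less_imp_le)
    qed
    then show "\<exists>M. \<forall>m\<ge>M. \<forall>n>m. dist (p m) (p n) < e" by (auto simp: dist_norm)
  qed
  then obtain v where v: "p \<longlonglongrightarrow> v" using Cauchy_convergent convergent_def by blast
  have "v \<in> K n" for n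
  proof (rule Lim_in_closed_set[OF K(2) _ _ v])
    show "\<forall>\<^sub>F m in sequentially. p m \<in> K n"
      using pK sub by (intro eventually_sequentiallyI[of n]) blast
  qed simp
  then show ?thesis by blast
qed

section \<open>Tail hulls and weak convergence\<close>

text \<open>For a bounded sequence in a Hilbert space, the intersection of these sets over all
  \<open>n\<close> is the closed convex hull of the weak cluster points.\<close>

definition tail_hull :: "(nat \<Rightarrow> 'a::real_normed_vector) \<Rightarrow> nat \<Rightarrow> 'a set" where
  "tail_hull x n = closure (convex hull (x ` {n..}))"

lemma tail_hull_subset:
  assumes "\<And>k. k \<ge> n \<Longrightarrow> x k \<in> K" "closed K" "convex K"
  shows "tail_hull x n \<subseteq> K"
  unfolding tail_hull_def using assms
  by (intro closure_minimal hull_minimal) auto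

lemma tail_hull_inter_nonempty:
  fixes x :: "nat \<Rightarrow> 'a::{real_inner,complete_space}"
  assumes "bounded (range x)"
  shows "(\<Inter>n. tail_hull x n) \<noteq> {}"
proof (rule nested_closed_convex_inter)
  show "decseq (tail_hull x)"
    unfolding tail_hull_def decseq_def by (intro allI impI closure_mono hull_mono image_mono) auto
  show "bounded (tail_hull x 0)"
    unfolding tail_hull_def using assms
    by (intro bounded_closure bounded_convex_hull) (auto intro: bounded_subset)
qed (auto simp: tail_hull_def convex_closure convex_convex_hull)

lemma tail_hull_inter_le:
  fixes f :: "'a::real_normed_vector \<Rightarrow> real"
  assumes f: "bounded_linear f" and v: "v \<in> (\<Inter>n. tail_hull x n)"
    and g: "g \<longlonglongrightarrow> c" and le: "\<forall>\<^sub>F k in sequentially. f (x k) \<le> g k"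
  shows "f v \<le> c"
proof (rule field_le_epsilon)
  fix e :: real assume "e > 0"
  then have "\<forall>\<^sub>F k in sequentially. g k < c + e" using order_tendstoD(2)[OF g] by simp
  with le have "\<forall>\<^sub>F k in sequentially. f (x k) \<le> c + e" by eventually_elim simp
  then obtain n where n: "\<And>k. k \<ge> n \<Longrightarrow> f (x k) \<le> c + e" by (auto simp: eventually_sequentially)
  have "convex (f -` {..c + e})" "closed (f -` {..c + e})"
    using f by (auto intro!: convex_linear_vimage closed_vimage bounded_linear.linear
      linear_continuous_on continuous_on_closed_vimage)
  then have "tail_hull x n \<subseteq> f -` {..c + e}"
    by (intro tail_hull_subset) (use n in auto)
  then show "f v \<le> c + e" using v by auto
qed

lemma tail_hull_inter_eq:
  fixes f :: "'a::real_normed_vector \<Rightarrow> real"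
  assumes f: "bounded_linear f" and v: "v \<in> (\<Inter>n. tail_hull x n)"
    and l: "(\<lambda>k. f (x k)) \<longlonglongrightarrow> l"
  shows "f v = l"
proof (rule antisym)
  show "f v \<le> l" by (rule tail_hull_inter_le[OF f v l]) simp
  have "- f v \<le> - l"
    by (rule tail_hull_inter_le[OF bounded_linear_minus[OF f] v tendsto_minus[OF l]]) simp
  then show "l \<le> f v" by simp
qed

text \<open>Convergence of the distances to two points of \<open>S\<close> makes the inner products
  with their difference converge, so tail-hull points of all subsequences coincide. A functional
  failing to converge to \<open>f v\<close> would stay away from it along a subsequence, and so
  would a tail-hull point of that subsequence. Hence \<open>cl\<close> ranges over
  subsequences.\<close>

lemma opial:
  fixes x :: "nat \<Rightarrow> 'a::{real_inner,complete_space}"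
  assumes S: "\<And>z. z \<in> S \<Longrightarrow> convergent (\<lambda>k. norm (x k - z))"
    and bd: "bounded (range x)"
    and cl: "\<And>r v. strict_mono r \<Longrightarrow> v \<in> (\<Inter>n. tail_hull (x \<circ> r) n) \<Longrightarrow> v \<in> S"
  shows "\<exists>v\<in>S. weakly_converges_to x v"
proof -
  obtain v where v: "v \<in> (\<Inter>n. tail_hull x n)" using tail_hull_inter_nonempty[OF bd] by blast
  have vS: "v \<in> S" using cl[of "\<lambda>n. n"] v by (simp add: strict_mono_def o_def)
  have uniq: "w = v" if r: "strict_mono r" and w: "w \<in> (\<Inter>n. tail_hull (x \<circ> r) n)" for r w
  proof -
    have "w \<in> S" by (rule cl[OF r w])
    then obtain a b where ab: "(\<lambda>k. norm (x k - v)) \<longlonglongrightarrow> a" "(\<lambda>k. norm (x k - w)) \<longlonglongrightarrow> b"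
      using S vS by (meson convergent_def)
    \<comment> \<open>Polarisation: \<open>l\<close> is the limit of
      \<open>x k \<bullet> (w - v)\<close>, and both \<open>v\<close> and \<open>w\<close> must
      attain it.\<close>
    define l where "l = (a\<^sup>2 - b\<^sup>2 - (norm v)\<^sup>2 + (norm w)\<^sup>2) / 2"
    have "(\<lambda>k. ((norm (x k - v))\<^sup>2 - (norm (x k - w))\<^sup>2 - (norm v)\<^sup>2 + (norm w)\<^sup>2) / 2) \<longlonglongrightarrow> l"
      unfolding l_def by (intro tendsto_intros ab) simp
    also have "(\<lambda>k. ((norm (x k - v))\<^sup>2 - (norm (x k - w))\<^sup>2 - (norm v)\<^sup>2 + (norm w)\<^sup>2) / 2)
        = (\<lambda>k. x k \<bullet> (w - v))"
      by (simp add: power2_norm_eq_inner inner_diff inner_commute diff_divide_distrib)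
    finally have l: "(\<lambda>k. x k \<bullet> (w - v)) \<longlonglongrightarrow> l" .
    have "v \<bullet> (w - v) = l"
      by (rule tail_hull_inter_eq[OF bounded_linear_inner_left v l])
    moreover have "w \<bullet> (w - v) = l"
      by (rule tail_hull_inter_eq[OF bounded_linear_inner_left w])
        (use LIMSEQ_subseq_LIMSEQ[OF l r] in \<open>simp add: o_def\<close>)
    ultimately have "(w - v) \<bullet> (w - v) = 0" by (simp add: inner_diff_left)
    then show ?thesis by simp
  qed
  have upper: "\<forall>\<^sub>F k in sequentially. f (x k) < f v + e"
    if f: "bounded_linear f" and e: "e > 0" for f :: "'a \<Rightarrow> real" and e
  proof (rule ccontr)
    assume "\<not> ?thesis"
    then have "\<exists>\<^sub>\<infinity>k. f v + e \<le> f (x k)"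
      by (simp add: not_eventually not_less cofinite_eq_sequentially)
    then obtain r :: "nat \<Rightarrow> nat" where r: "strict_mono r" "\<And>n. f v + e \<le> f (x (r n))"
      using infinite_enumerate[of "{k. f v + e \<le> f (x k)}"] by (auto simp: INFM_iff_infinite)
    have "bounded (range (x \<circ> r))" using bd by (rule bounded_subset) auto
    then obtain w where w: "w \<in> (\<Inter>n. tail_hull (x \<circ> r) n)"
      using tail_hull_inter_nonempty by blast
    have "- f w \<le> - (f v + e)"
      by (rule tail_hull_inter_le[OF bounded_linear_minus[OF f] w tendsto_const])
        (use r(2) in \<open>auto intro!: always_eventually simp: algebra_simps\<close>)
    with uniq[OF r(1) w] e show False by simp
  qed
  have "(\<lambda>k. f (x k)) \<longlonglongrightarrow> f v" if f: "bounded_linear f" for f :: "'a \<Rightarrow> real"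
  proof (rule order_tendstoI)
    fix a assume "f v < a"
    with upper[OF f, of "a - f v"] show "\<forall>\<^sub>F k in sequentially. f (x k) < a" by simp
  next
    fix a assume "a < f v"
    with upper[OF bounded_linear_minus[OF f], of "f v - a"]
    show "\<forall>\<^sub>F k in sequentially. a < f (x k)" by simp
  qed
  with vS show ?thesis unfolding weakly_converges_to_def by blast
qed

section \<open>Scalar recursion and the one-step energy estimate\<close>

text \<open>Since \<open>1 + b k \<le> exp (b k)\<close>, the sequence \<open>V\<close> is bounded
  by \<open>M\<close>. The multiplicative error then becomes the summable additive error
  \<open>M * b k\<close>, and telescoping applies.\<close>

lemma quasi_fejer:
  fixes V t b :: "nat \<Rightarrow> real"
  assumes V: "\<And>k. 0 \<le> V k" and t: "\<And>k. 0 \<le> t k" and b: "\<And>k. 0 \<le> b k" "summable b"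
    and step: "\<And>k. V (Suc k) + t k \<le> (1 + b k) * V k"
  shows "convergent V" and "summable t"
proof -
  define M where "M = V 0 * exp (suminf b)"
  have "V k \<le> V 0 * exp (\<Sum>i<k. b i)" for k
  proof (induction k)
    case (Suc k)
    have "V (Suc k) \<le> (1 + b k) * V k" using step[of k] t[of k] by linarith
    also have "\<dots> \<le> exp (b k) * (V 0 * exp (\<Sum>i<k. b i))"
      using Suc V by (intro mult_mono) auto
    finally show ?case by (simp add: exp_add mult_ac)
  qed simp
  also have "V 0 * exp (\<Sum>i<k. b i) \<le> M" for k
    unfolding M_def using V b by (intro mult_left_mono) (auto intro: sum_le_suminf)
  finally have VM: "V k \<le> M" for k .
  have M0: "M \<ge> 0" unfolding M_def using V by simp
  have step': "V (Suc k) + t k \<le> V k + M * b k" for k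
    using step[of k] mult_right_mono[OF VM[of k] b(1)[of k]] by (simp add: algebra_simps)
  have sum: "V k + (\<Sum>i<k. t i) \<le> V 0 + M * (\<Sum>i<k. b i)" for k
    by (induction k) (use step' in \<open>simp_all add: algebra_simps\<close>, smt (verit))
  show t': "summable t"
  proof (rule summableI_nonneg_bounded)
    fix n
    have "M * (\<Sum>i<n. b i) \<le> M * suminf b" using b M0 by (intro mult_left_mono sum_le_suminf) auto
    then show "(\<Sum>i<n. t i) \<le> V 0 + M * suminf b" using sum[of n] V[of n] by linarith
  qed (rule t)
  \<comment> \<open>Adding the accumulated decrease and removing the accumulated error gives a
    nonincreasing sequence, bounded below.\<close>
  define W where "W k = V k + (\<Sum>i<k. t i) - M * (\<Sum>i<k. b i)" for k
  have low: "- (M * suminf b) \<le> W k" for k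
  proof -
    have "M * (\<Sum>i<k. b i) \<le> M * suminf b" using b M0 by (intro mult_left_mono sum_le_suminf) auto
    moreover have "0 \<le> (\<Sum>i<k. t i)" using t by (intro sum_nonneg) auto
    ultimately show ?thesis unfolding W_def using V[of k] by linarith
  qed
  have "decseq W" unfolding W_def using step' by (intro decseq_SucI) (simp add: algebra_simps)
  then have "convergent W" using low by (metis decseq_convergent convergent_def)
  then have "convergent (\<lambda>k. W k - (\<Sum>i<k. t i) + M * (\<Sum>i<k. b i))"
    using t' b by (intro convergent_add convergent_diff convergent_mult convergent_const)
      (simp_all add: summable_iff_convergent)
  then show "convergent V" by (simp add: W_def)
qed

text \<open>
  The terms in \<open>u0 - x0\<close> and \<open>x1 - u0\<close> are absorbed by the left-hand side of the preceding step,
  since \<open>19/40 < 11/20\<close> and \<open>1/4 < 7/20\<close>.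
\<close>
lemma reflected_step:
  fixes x0 x1 x2 u0 u1 z b0 b1 bz :: "'a::real_inner"
  assumes x2z: "0 \<le> (x2 - x1 + lam *\<^sub>R b1) \<bullet> (z - x2)"
    and x1x2: "0 \<le> (x1 - x0 + lam *\<^sub>R b0) \<bullet> (x2 - x1)"
    and x1x0: "0 \<le> (x1 - x0 + lam *\<^sub>R b0) \<bullet> (x0 - x1)"
    and mono: "0 \<le> (b1 - bz) \<bullet> (u1 - z)"
    and lip1: "norm (b1 - b0) \<le> L * norm (u1 - u0)"
    and lip0: "norm (b0 - bz) \<le> L * norm (u0 - z)"
    and u1: "u1 - x1 = (x1 - x0) - \<beta> *\<^sub>R (u0 - x0)"
    and \<beta>: "0 \<le> \<beta>" "\<beta> \<le> 1/4" and lam: "0 < lam" "0 < L" "lam * L \<le> 1/5"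
  shows "(norm (x2 - z))\<^sup>2 + 11/20 * (norm (u1 - x1))\<^sup>2 + 7/20 * (norm (x2 - u1))\<^sup>2
      + 4 * lam * (bz \<bullet> (x1 - z))
    \<le> (1 + \<beta>) * (norm (x1 - z))\<^sup>2 + 19/40 * (norm (u0 - x0))\<^sup>2 + 1/4 * (norm (x1 - u0))\<^sup>2
      + 2 * lam * (bz \<bullet> (x0 - z))"
proof -
  define d where "d = x1 - x0"
  define e0 where "e0 = u0 - x0"
  define e1 where "e1 = u1 - x1"
  define q where "q = x2 - u1"
  define m where "m = lam * L"
  have m: "0 < m" "m \<le> 1/5" unfolding m_def using lam by auto
  have d: "d = e1 + \<beta> *\<^sub>R e0" using u1 by (simp add: d_def e0_def e1_def)
  \<comment> \<open>This is twice the sum of the three projection inequalities and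
    \<open>lam\<close> times monotonicity. Here \<open>q - \<beta> *\<^sub>R e0\<close> equals
    \<open>x2 - x1 - d\<close>, and the coefficients 4 and 2 come from \<open>u1 - z\<close> being
    \<open>2 (x1 - z) - (x0 - z)\<close> minus \<open>\<beta> *\<^sub>R e0\<close>.\<close>
  have main: "(norm (x2 - z))\<^sup>2 \<le> (norm (x1 - z))\<^sup>2 - (norm d)\<^sup>2 - (norm (q - \<beta> *\<^sub>R e0))\<^sup>2
      + 2 * lam * ((b1 - b0) \<bullet> (u1 - x2)) - 2 * lam * \<beta> * ((b0 - bz) \<bullet> e0)
      - 4 * lam * (bz \<bullet> (x1 - z)) + 2 * lam * (bz \<bullet> (x0 - z))"
  proof -
    have m': "0 \<le> lam * ((b1 - bz) \<bullet> (u1 - z))" using mono lam by simp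
    have ux: "u1 = x1 + (x1 - x0) - \<beta> *\<^sub>R e0" using u1 by (simp add: e0_def algebra_simps)
    show ?thesis
      using x2z x1x2 x1x0 m'
      unfolding power2_norm_eq_inner d_def q_def ux
      by (simp add: inner_diff inner_add inner_commute algebra_simps)
  qed
  have sq: "(norm d)\<^sup>2 + (norm (q - \<beta> *\<^sub>R e0))\<^sup>2
      \<ge> (1 - \<beta>) * ((norm e1)\<^sup>2 + (norm q)\<^sup>2) - 2 * \<beta> * (1 - \<beta>) * (norm e0)\<^sup>2"
  proof -
    \<comment> \<open>This is exactly the difference of the two sides of \<open>sq\<close>.\<close>
    have "0 \<le> \<beta> * ((norm (e1 + e0))\<^sup>2 + (norm (q - e0))\<^sup>2)" using \<beta> by simp
    then show ?thesis
      unfolding d power2_norm_eq_inner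
      by (simp add: inner_diff inner_add inner_commute algebra_simps)
  qed
  have young: "2 * a * b \<le> a\<^sup>2 + b\<^sup>2" for a b :: real
    using zero_le_power2[of "a - b"] by (simp add: power2_diff)
  have lip1': "2 * lam * ((b1 - b0) \<bullet> (u1 - x2))
      \<le> m * ((norm e1)\<^sup>2 + (norm (x1 - u0))\<^sup>2 + 2 * (norm q)\<^sup>2)"
  proof -
    have "norm (u1 - u0) \<le> norm e1 + norm (x1 - u0)"
      unfolding e1_def by (metis diff_add_cancel add_diff_eq norm_triangle_ineq)
    then have "norm (b1 - b0) \<le> L * (norm e1 + norm (x1 - u0))"
      using lip1 lam by (smt (verit) mult_left_mono)
    moreover have "(b1 - b0) \<bullet> (u1 - x2) \<le> norm (b1 - b0) * norm q"
      unfolding q_def by (metis norm_cauchy_schwarz norm_minus_commute)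
    ultimately have "(b1 - b0) \<bullet> (u1 - x2) \<le> L * (norm e1 + norm (x1 - u0)) * norm q"
      by (smt (verit) mult_right_mono norm_ge_zero)
    then have "2 * lam * ((b1 - b0) \<bullet> (u1 - x2)) \<le> 2 * lam * (L * (norm e1 + norm (x1 - u0)) * norm q)"
      using lam by (intro mult_left_mono) auto
    also have "\<dots> = m * (2 * norm e1 * norm q + 2 * norm (x1 - u0) * norm q)"
      by (simp add: m_def algebra_simps)
    also have "\<dots> \<le> m * (((norm e1)\<^sup>2 + (norm q)\<^sup>2) + ((norm (x1 - u0))\<^sup>2 + (norm q)\<^sup>2))"
      using m by (intro mult_left_mono add_mono young) auto
    finally show ?thesis by (simp add: algebra_simps)
  qed
  \<comment> \<open>Passing from \<open>u0\<close> to \<open>z\<close> through \<open>x1\<close>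
    leaves a multiple of the squared norm of \<open>x1 - z\<close>, the source of the factor
    \<open>1 + \<beta>\<close>.\<close>
  have lip0': "- 2 * lam * \<beta> * ((b0 - bz) \<bullet> e0)
      \<le> m * \<beta> * ((norm (x1 - z))\<^sup>2 + (norm (x1 - u0))\<^sup>2 + 2 * (norm e0)\<^sup>2)"
  proof -
    have "norm (u0 - z) \<le> norm (x1 - z) + norm (x1 - u0)"
      by (metis dist_norm dist_triangle add.commute dist_commute)
    then have "norm (b0 - bz) \<le> L * (norm (x1 - z) + norm (x1 - u0))"
      using lip0 lam by (smt (verit) mult_left_mono)
    moreover have "- ((b0 - bz) \<bullet> e0) \<le> norm (b0 - bz) * norm e0"
      using Cauchy_Schwarz_ineq2[of "b0 - bz" e0] by linarith
    ultimately have "- ((b0 - bz) \<bullet> e0) \<le> L * (norm (x1 - z) + norm (x1 - u0)) * norm e0"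
      by (smt (verit) mult_right_mono norm_ge_zero)
    then have "2 * lam * \<beta> * - ((b0 - bz) \<bullet> e0)
        \<le> 2 * lam * \<beta> * (L * (norm (x1 - z) + norm (x1 - u0)) * norm e0)"
      using lam \<beta> by (intro mult_left_mono) auto
    also have "\<dots> = m * \<beta> * (2 * norm (x1 - z) * norm e0 + 2 * norm (x1 - u0) * norm e0)"
      by (simp add: m_def algebra_simps)
    also have "\<dots> \<le> m * \<beta> * (((norm (x1 - z))\<^sup>2 + (norm e0)\<^sup>2) + ((norm (x1 - u0))\<^sup>2 + (norm e0)\<^sup>2))"
      using m \<beta> by (intro mult_left_mono add_mono young) auto
    finally show ?thesis by (simp add: algebra_simps)
  qed
  have mb: "m * \<beta> \<le> 1/5 * \<beta>" "1/5 * \<beta> \<le> 1/20" using mult_right_mono[OF m(2) \<beta>(1)] \<beta> by auto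
  \<comment> \<open>The constants are the extreme cases \<open>\<beta> = 1/4\<close>,
    \<open>m = 1/5\<close>: on the left remain 1 - 9/20 = 11/20 and 1 - 13/20 = 7/20; on the right
    appear 1/5 + 1/20 = 1/4 and 3/8 + 1/10 = 19/40.\<close>
  have c1: "(\<beta> + m) * (norm e1)\<^sup>2 \<le> 9/20 * (norm e1)\<^sup>2"
    using m \<beta> by (intro mult_right_mono) auto
  have c2: "(\<beta> + 2 * m) * (norm q)\<^sup>2 \<le> 13/20 * (norm q)\<^sup>2"
    using m \<beta> by (intro mult_right_mono) auto
  have c3: "(m + m * \<beta>) * (norm (x1 - u0))\<^sup>2 \<le> 1/4 * (norm (x1 - u0))\<^sup>2"
    using m mb by (intro mult_right_mono) auto
  have "\<beta> * (1 - \<beta>) \<le> 3/16"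
    using mult_nonneg_nonneg[of "1/4 - \<beta>" "3/4 - \<beta>"] \<beta> by (simp add: field_simps)
  then have c4: "(2 * (\<beta> * (1 - \<beta>)) + 2 * (m * \<beta>)) * (norm e0)\<^sup>2 \<le> 19/40 * (norm e0)\<^sup>2"
    using mb by (intro mult_right_mono) auto
  have c5: "m * \<beta> * (norm (x1 - z))\<^sup>2 \<le> \<beta> * (norm (x1 - z))\<^sup>2"
    using mb \<beta> by (intro mult_right_mono) auto
  show ?thesis
    using main sq lip1' lip0' c1 c2 c3 c4 c5
    unfolding e0_def[symmetric] e1_def[symmetric] q_def[symmetric]
    by (simp add: algebra_simps)
qed

section \<open>Minty's characterisation and the convergence theorem\<close>

text \<open>The hypothesis is applied at points \<open>y n\<close> of the segment from
  \<open>v\<close> to \<open>w\<close>. Dividing by the step \<open>1 / Suc n\<close> and letting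
  \<open>y n\<close> tend to \<open>v\<close>, continuity replaces \<open>B (y n)\<close> by
  \<open>B v\<close>.\<close>

lemma VI_solutions_minty:
  fixes B :: "'a::real_inner \<Rightarrow> 'a"
  assumes B: "continuous_on UNIV B" and C: "convex C" and v: "v \<in> C"
    and le: "\<And>y. y \<in> C \<Longrightarrow> 0 \<le> B y \<bullet> (y - v)"
  shows "v \<in> VI_solutions C B"
proof -
  have "0 \<le> B v \<bullet> (w - v)" if w: "w \<in> C" for w
  proof (rule LIMSEQ_le_const)
    define y where "y n = (1 - 1 / real (Suc n)) *\<^sub>R v + (1 / real (Suc n)) *\<^sub>R w" for n
    have "y \<longlonglongrightarrow> (1 - 0) *\<^sub>R v + 0 *\<^sub>R w"
      unfolding y_def by (intro tendsto_intros LIMSEQ_Suc lim_1_over_n)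
    then have "y \<longlonglongrightarrow> v" by simp
    then have "(\<lambda>n. B (y n)) \<longlonglongrightarrow> B v"
      by (intro continuous_on_tendsto_compose[OF B]) auto
    then show "(\<lambda>n. B (y n) \<bullet> (w - v)) \<longlonglongrightarrow> B v \<bullet> (w - v)"
      by (intro tendsto_intros)
    have "0 \<le> B (y n) \<bullet> (w - v)" for n
    proof -
      have "y n \<in> C" unfolding y_def using v w by (intro convexD[OF C]) auto
      from le[OF this] have "0 \<le> B (y n) \<bullet> ((1 / real (Suc n)) *\<^sub>R (w - v))"
        unfolding y_def by (simp add: algebra_simps)
      then show ?thesis by (simp add: zero_le_mult_iff zero_le_divide_iff)
    qed
    then show "\<exists>N. \<forall>n\<ge>N. 0 \<le> B (y n) \<bullet> (w - v)" by blast
  qed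
  then show ?thesis unfolding VI_solutions_def using v by blast
qed

theorem theorem4p1:
  fixes C :: "'a::{real_inner,complete_space} set"
    and B :: "'a \<Rightarrow> 'a"
    and L lam :: real
    and \<beta> \<theta> :: "nat \<Rightarrow> real"
    and x u :: "nat \<Rightarrow> 'a"
  assumes "C \<noteq> {}" and "closed C" and "convex C"
    and "monotone_operator B"
    and "L > 0" and "L-lipschitz_on UNIV B"
    and "VI_solutions C B \<noteq> {}"
    and "\<And>k. 0 \<le> \<beta> k" and "\<And>k. \<beta> k \<le> 1 / 4" and "summable \<beta>"
    and "\<And>k. \<theta> k = 1 - \<beta> k"
    and "0 < lam" and "lam < 1 / (5 * L)"
    and "x 0 \<in> C" and "u 0 = x 0"
    and "\<And>k. x (k + 1) = metric_proj C (x k - lam *\<^sub>R B (u k))"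
    and "\<And>k. k \<ge> 1 \<Longrightarrow>
           u k = x k + \<theta> k *\<^sub>R (x k - x (k - 1)) + \<beta> k *\<^sub>R (x k - u (k - 1))"
  shows "(\<exists>z\<in>VI_solutions C B. weakly_converges_to x z)
       \<and> (\<lambda>k. norm (x (k + 1) - x k)) \<longlonglongrightarrow> 0
       \<and> (\<lambda>k. norm (u k - x k)) \<longlonglongrightarrow> 0"
proof -
  let ?S = "VI_solutions C B"
  note C = assms(1-3) and L = assms(5) and lam = assms(12)
  have lamL: "lam * L \<le> 1/5" using assms(13) L by (simp add: field_simps)
  have lip: "norm (B a - B b) \<le> L * norm (a - b)" for a b
    using lipschitz_onD[OF assms(6), of a b] by (simp add: dist_norm)
  have B_mono: "0 \<le> (B a - B b) \<bullet> (a - b)" for a b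
    using assms(4) unfolding monotone_operator_def by blast
  have x_Suc: "x (Suc k) = metric_proj C (x k - lam *\<^sub>R B (u k))" for k using assms(16)[of k] by simp
  have xC: "x k \<in> C" for k
    by (cases k) (use assms(14) metric_proj_in[OF C] in \<open>simp_all add: x_Suc\<close>)
  have proj: "0 \<le> (x (Suc k) - x k + lam *\<^sub>R B (u k)) \<bullet> (y - x (Suc k))" if "y \<in> C" for k y
    using metric_proj_variational[OF C that, of "x k - lam *\<^sub>R B (u k)"]
    unfolding x_Suc[symmetric] by (simp add: inner_diff inner_add)
  have e_Suc: "u (Suc k) - x (Suc k) = (x (Suc k) - x k) - \<beta> (Suc k) *\<^sub>R (u k - x k)" for k
    using assms(17)[of "Suc k"] by (simp add: assms(11) algebra_simps)
  have fejer: "convergent (\<lambda>k. norm (x k - z)) \<and> (\<lambda>k. norm (u k - x k)) \<longlonglongrightarrow> 0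
      \<and> (\<lambda>k. norm (x (Suc k) - u k)) \<longlonglongrightarrow> 0" if z: "z \<in> ?S" for z
  proof -
    have zC: "z \<in> C" and a: "0 \<le> B z \<bullet> (x k - z)" for k
      using z xC unfolding VI_solutions_def by auto
    \<comment> \<open>\<open>V k\<close> is the right-hand side of \<open>reflected_step\<close>
      without the factor \<open>1 + \<beta>\<close>; the shift to \<open>Suc k\<close> keeps all
      indices nonnegative.\<close>
    define V where "V k = (norm (x (Suc k) - z))\<^sup>2 + 19/40 * (norm (u k - x k))\<^sup>2
      + 1/4 * (norm (x (Suc k) - u k))\<^sup>2 + 2 * lam * (B z \<bullet> (x k - z))" for k
    \<comment> \<open>The surplus of the left-hand coefficients over those in \<open>V\<close>:
      11/20 - 19/40, 7/20 - 1/4 and \<open>4 * lam - 2 * lam\<close>.\<close>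
    define t where "t k = 3/40 * (norm (u (Suc k) - x (Suc k)))\<^sup>2
      + 1/10 * (norm (x (Suc (Suc k)) - u (Suc k)))\<^sup>2 + 2 * lam * (B z \<bullet> (x (Suc k) - z))" for k
    have V0: "0 \<le> V k" and t0: "0 \<le> t k" for k
      unfolding V_def t_def using a lam by simp_all
    have step: "V (Suc k) + t k \<le> (1 + \<beta> (Suc k)) * V k" for k
    proof -
      have "V (Suc k) + t k \<le> V k + \<beta> (Suc k) * (norm (x (Suc k) - z))\<^sup>2"
        using reflected_step[OF proj[OF zC, of "Suc k"] proj[OF xC[of "Suc (Suc k)"], of k]
            proj[OF xC[of k], of k] B_mono lip lip e_Suc assms(8,9) lam L lamL]
        unfolding V_def t_def by (simp add: algebra_simps)
      also have "\<dots> \<le> V k + \<beta> (Suc k) * V k"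
        unfolding V_def using a lam assms(8) by (intro add_left_mono mult_left_mono) simp_all
      finally show ?thesis by (simp add: algebra_simps)
    qed
    have "summable (\<lambda>k. \<beta> (Suc k))" using assms(10) by (simp add: summable_Suc_iff)
    note qf = quasi_fejer[OF V0 t0 assms(8) this step]
    have t_lim: "t \<longlonglongrightarrow> 0" by (rule summable_LIMSEQ_zero[OF qf(2)])
    have lims: "(\<lambda>k. (norm (u k - x k))\<^sup>2) \<longlonglongrightarrow> 0" "(\<lambda>k. (norm (x (Suc k) - u k))\<^sup>2) \<longlonglongrightarrow> 0"
      "(\<lambda>k. B z \<bullet> (x k - z)) \<longlonglongrightarrow> 0"
    proof -
      have *: "f \<longlonglongrightarrow> 0" if "c > 0" "\<And>k. 0 \<le> f k" "\<And>k. c * f (Suc k) \<le> t k" for f :: "nat \<Rightarrow> real" and c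
      proof -
        have "(\<lambda>k. f (Suc k)) \<longlonglongrightarrow> 0"
        proof (rule tendsto_sandwich[OF _ _ tendsto_const])
          show "(\<lambda>k. t k / c) \<longlonglongrightarrow> 0" using tendsto_divide[OF t_lim tendsto_const, of c] that(1) by simp
        qed (use that in \<open>auto simp: field_simps\<close>)
        then show ?thesis by (rule LIMSEQ_imp_Suc)
      qed
      show "(\<lambda>k. (norm (u k - x k))\<^sup>2) \<longlonglongrightarrow> 0" by (rule *[of "3/40"]) (use a lam in \<open>simp_all add: t_def\<close>)
      show "(\<lambda>k. (norm (x (Suc k) - u k))\<^sup>2) \<longlonglongrightarrow> 0" by (rule *[of "1/10"]) (use a lam in \<open>simp_all add: t_def\<close>)
      show "(\<lambda>k. B z \<bullet> (x k - z)) \<longlonglongrightarrow> 0" by (rule *[of "2 * lam"]) (use a lam in \<open>simp_all add: t_def\<close>)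
    qed
    \<comment> \<open>All terms of \<open>V\<close> except the squared distance to \<open>z\<close>
      vanish, so that distance converges.\<close>
    obtain l where "V \<longlonglongrightarrow> l" using qf(1) by (auto simp: convergent_def)
    then have "(\<lambda>k. V k - 19/40 * (norm (u k - x k))\<^sup>2 - 1/4 * (norm (x (Suc k) - u k))\<^sup>2
        - 2 * lam * (B z \<bullet> (x k - z))) \<longlonglongrightarrow> l - 19/40 * 0 - 1/4 * 0 - 2 * lam * 0"
      by (intro tendsto_intros lims)
    then have "(\<lambda>k. sqrt ((norm (x (Suc k) - z))\<^sup>2)) \<longlonglongrightarrow> sqrt l"
      unfolding V_def by (intro tendsto_real_sqrt) simp
    then have "(\<lambda>k. norm (x k - z)) \<longlonglongrightarrow> sqrt l" by (simp add: LIMSEQ_imp_Suc)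
    then show ?thesis
      using tendsto_real_sqrt[OF lims(1)] tendsto_real_sqrt[OF lims(2)] by (auto simp: convergent_def)
  qed
  obtain z0 where z0: "z0 \<in> ?S" using assms(7) by blast
  have e: "(\<lambda>k. u k - x k) \<longlonglongrightarrow> 0" and q: "(\<lambda>k. x (Suc k) - u k) \<longlonglongrightarrow> 0"
    using fejer[OF z0] by (auto simp: tendsto_norm_zero_iff)
  have d: "(\<lambda>k. x (Suc k) - x k) \<longlonglongrightarrow> 0" using tendsto_add[OF q e] by simp
  have "Bseq (\<lambda>k. x k - z0)"
    using fejer[OF z0] by (auto simp: Bseq_def dest!: convergent_imp_Bseq)
  then have xB: "Bseq x" using Bseq_add[of "\<lambda>k. x k - z0" z0] by simp
  have "Bseq (\<lambda>k. u k - x k)" using e by (intro convergent_imp_Bseq) (auto simp: convergent_def)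
  then obtain M1 M2 where M: "\<And>k. norm (u k - x k) \<le> M1" "\<And>k. norm (x k) \<le> M2"
    using xB unfolding Bseq_def by blast
  have "norm (B (u k)) \<le> norm (B 0) + L * (M1 + M2)" for k
  proof -
    have "norm (u k) \<le> M1 + M2"
      using norm_triangle_ineq[of "u k - x k" "x k"] M[of k] by simp
    then have "norm (B (u k) - B 0) \<le> L * (M1 + M2)"
      using lip[of "u k" 0] L by (smt (verit) diff_zero mult_left_mono)
    then show ?thesis using norm_triangle_ineq[of "B (u k) - B 0" "B 0"] by simp
  qed
  then have BB: "Bseq (\<lambda>k. B (u k))" by (intro BseqI') 
  have "\<exists>z\<in>?S. weakly_converges_to x z"
  proof (rule opial)
    show "bounded (range x)" using M(2) by (auto simp: bounded_iff)
    show "convergent (\<lambda>k. norm (x k - z))" if "z \<in> ?S" for z using fejer[OF that] by blast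
    fix r v assume r: "strict_mono r" and v: "v \<in> (\<Inter>n. tail_hull (x \<circ> r) n)"
    show "v \<in> ?S"
    proof (rule VI_solutions_minty)
      show "continuous_on UNIV B" using assms(6) by (rule lipschitz_on_continuous_on)
      show "convex C" by (rule C)
      have "tail_hull (x \<circ> r) 0 \<subseteq> C" using xC C by (intro tail_hull_subset) auto
      then show "v \<in> C" using v by blast
      fix y assume y: "y \<in> C"
      \<comment> \<open>The projection inequality and monotonicity give \<open>g k\<close> as a
        lower bound for \<open>lam * (B y \<bullet> (y - x k))\<close>. Each term of
        \<open>g\<close> pairs a vanishing factor with a bounded one.\<close>
      define g where "g k = lam * (B y \<bullet> (u k - x k)) + lam * (B (u k) \<bullet> (x (Suc k) - u k))
        - (x (Suc k) - x k) \<bullet> (y - x (Suc k))" for k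
      have yB: "Bseq (\<lambda>k. y - x (Suc k))"
        using M(2) by (intro BseqI'[of _ "norm y + M2"]) (meson norm_triangle_ineq4 add_left_mono order_trans)
      have "g \<longlonglongrightarrow> lam * 0 + lam * 0 - 0"
        unfolding g_def
      proof (intro tendsto_diff tendsto_add tendsto_mult_left)
        show "(\<lambda>k. B y \<bullet> (u k - x k)) \<longlonglongrightarrow> 0" using tendsto_inner[OF tendsto_const e, of "B y"] by simp
        show "(\<lambda>k. B (u k) \<bullet> (x (Suc k) - u k)) \<longlonglongrightarrow> 0"
          using bounded_bilinear.Bfun_prod_Zfun[OF bounded_bilinear_inner BB] q by (simp add: tendsto_Zfun_iff)
        show "(\<lambda>k. (x (Suc k) - x k) \<bullet> (y - x (Suc k))) \<longlonglongrightarrow> 0"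
          using bounded_bilinear.Zfun_prod_Bfun[OF bounded_bilinear_inner _ yB] d by (simp add: tendsto_Zfun_iff)

      qed
      then have g0: "g \<longlonglongrightarrow> 0" by simp
      have gle: "lam * (B y \<bullet> x k) \<le> lam * (B y \<bullet> y) - g k" for k
      proof -
        have "0 \<le> lam * ((B y - B (u k)) \<bullet> (y - u k))" using B_mono lam by simp
        then show ?thesis
          using proj[OF y, of k] unfolding g_def
          by (simp add: inner_diff inner_add algebra_simps)
      qed
      \<comment> \<open>With \<open>B\<close> evaluated at the fixed \<open>y\<close>, the
        inequality is affine in \<open>x k\<close> up to a vanishing error, so it passes to the
        tail-hull point \<open>v\<close>.\<close>
      have "lam * (B y \<bullet> v) \<le> lam * (B y \<bullet> y)"
      proof (rule tail_hull_inter_le[OF _ v])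
        show "bounded_linear (\<lambda>w. lam * (B y \<bullet> w))"
          by (intro bounded_linear_const_mult bounded_linear_inner_right)
        show "(\<lambda>k. lam * (B y \<bullet> y) - g (r k)) \<longlonglongrightarrow> lam * (B y \<bullet> y)"
          using tendsto_diff[OF tendsto_const LIMSEQ_subseq_LIMSEQ[OF g0 r], of "lam * (B y \<bullet> y)"]
          by (simp add: o_def)
      qed (use gle in simp)
      then show "0 \<le> B y \<bullet> (y - v)" using lam by (simp add: inner_diff)
    qed
  qed
  then show ?thesis using tendsto_norm_zero[OF e] tendsto_norm_zero[OF d] by simp
qed

end
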